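(* Let $\mathbb{K}$ be a field, let $G$ be a graph with vertex set $\{v_1,\dots,v_n\}$, and let $I=I(G)\subseteq S=\mathbb{K}[x_1,\dots,x_n]$ be its edge ideal. Suppose that $p$ is the number of bipartite connected components of $G$. Then for every integer $k\geq 1$, we have $\mathrm{sdepth}(S/I^k)\geq p$.
   Context: Graphs are finite and simple. The edge ideal $I(G)$ is the ideal of $S=\mathbb{K}[x_1,\dots,x_n]$ generated by the squarefree monomials $x_ix_j$ with $\{v_i,v_j\}$ an edge of $G$. An isolated vertex counts as a bipartite connected component. Stanley depth: let $M$ be a finitely generated $\mathbb{Z}^n$-graded $S$-module, $u\in M$ a homogeneous element and $Z\subseteq\{x_1,\dots,x_n\}$. The $\mathbb{K}$-subspace $u\mathbb{K}[Z]$ generated by all $uv$ with $v\in\mathbb{K}[Z]$ is called a Stanley space of dimension $|Z|$ if it is a free $\mathbb{K}[Z]$-module. A Stanley decomposition $\mathcal{D}$ of $M$ is a decomposition of $M$ (as a $\mathbb{K}$-vector space) as a finite direct sum of Stanley spaces; $\mathrm{sdepth}(\mathcal{D})$ is the minimum dimension of a Stanley space in $\mathcal{D}$, and $\mathrm{sdepth}(M)$ is the maximum of $\mathrm{sdepth}(\mathcal{D})$ over all Stanley decompositions $\mathcal{D}$ of $M$. *)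

theory Defs
  imports
    "HOL-Algebra.Ideal_Product"
    "HOL-Algebra.QuotRing"
    "HOL-Algebra.Module"
    "HOL-Algebra.Algebraic_Closure_Type"
    "HOL-Library.Poly_Mapping"
    "HOL-Library.Extended_Nat"
begin

section \<open>Graphs\<close>

text \<open>
  A simple graph with vertex set \<^term>\<open>UNIV :: 'n::finite set\<close> is given by a symmetric
  irreflexive edge relation. The components are vertex sets; an isolated vertex \<open>i\<close> yields the
  component \<open>{i}\<close>, which is bipartite.
\<close>

definition components :: "('n \<times> 'n) set \<Rightarrow> 'n set set" where
  "components E = UNIV // E\<^sup>*"

definition bipartite_on :: "('n \<times> 'n) set \<Rightarrow> 'n set \<Rightarrow> bool" where
  "bipartite_on E C \<longleftrightarrow>
     (\<exists>A B. A \<union> B = C \<and> A \<inter> B = {} \<and>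
        (\<forall>(i, j) \<in> E \<inter> C \<times> C. (i \<in> A \<and> j \<in> B) \<or> (i \<in> B \<and> j \<in> A)))"

section \<open>The polynomial ring, edge ideals\<close>

text \<open>Polynomials over \<open>'k\<close> in the variables \<open>x\<^sub>i\<close>, \<open>i :: 'n\<close>: finitely supported maps from
  exponent vectors to coefficients.\<close>

type_synonym ('n, 'k) mpoly = "('n \<Rightarrow>\<^sub>0 nat) \<Rightarrow>\<^sub>0 'k"

abbreviation mpoly_ring :: "('n, 'k::field) mpoly ring" where
  "mpoly_ring \<equiv> ring_of_type_algebra"

definition mvar :: "'n \<Rightarrow> ('n, 'k::field) mpoly" where
  "mvar i = Poly_Mapping.single (Poly_Mapping.single i 1) 1"

definition edge_ideal :: "('n \<times> 'n) set \<Rightarrow> ('n, 'k::field) mpoly set" where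
  "edge_ideal E = Idl\<^bsub>mpoly_ring\<^esub> {mvar i * mvar j | i j. (i, j) \<in> E}"

text \<open>The underlying set of the subring \<open>K[Z]\<close>.\<close>

definition polys_in :: "'n set \<Rightarrow> ('n, 'k::field) mpoly set" where
  "polys_in Z = {f. \<forall>m \<in> Poly_Mapping.keys f. Poly_Mapping.keys m \<subseteq> Z}"

section \<open>Stanley depth\<close>

definition free_module :: "('a, 'r) ring_scheme \<Rightarrow> ('a, 'm, 'e) module_scheme \<Rightarrow> bool" where
  "free_module R M \<longleftrightarrow> module R M \<and>
     (\<exists>B \<subseteq> carrier M. \<forall>x \<in> carrier M.
        \<exists>!c. c \<in> B \<rightarrow>\<^sub>E carrier R \<and> finite {b \<in> B. c b \<noteq> \<zero>\<^bsub>R\<^esub>} \<and>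
             x = finsum M (\<lambda>b. c b \<odot>\<^bsub>M\<^esub> b) {b \<in> B. c b \<noteq> \<zero>\<^bsub>R\<^esub>})"

text \<open>
  Let \<open>M\<close> be a finitely generated \<open>\<int>\<^sup>n\<close>-graded module over the polynomial ring, the grading being the family \<open>gr\<close>
  of its graded components. Since \<open>K[Z]\<close> is a \<open>K\<close>-algebra, the set \<open>u K[Z]\<close> below already is the
  \<open>K\<close>-subspace spanned by its elements.
\<close>

definition mult_space ::
  "(('n, 'k::field) mpoly, 'm, 'e) module_scheme \<Rightarrow> 'm \<Rightarrow> 'n set \<Rightarrow> 'm set" where
  "mult_space M u Z = (\<lambda>v. v \<odot>\<^bsub>M\<^esub> u) ` polys_in Z"

definition homogeneous :: "(('n \<Rightarrow> int) \<Rightarrow> 'm set) \<Rightarrow> 'm \<Rightarrow> bool" where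
  "homogeneous gr u \<longleftrightarrow> (\<exists>a. u \<in> gr a)"

definition stanley_space ::
  "(('n, 'k::field) mpoly, 'm, 'e) module_scheme \<Rightarrow> (('n \<Rightarrow> int) \<Rightarrow> 'm set) \<Rightarrow>
    'm \<Rightarrow> 'n set \<Rightarrow> bool" where
  "stanley_space M gr u Z \<longleftrightarrow>
     u \<in> carrier M \<and> homogeneous gr u \<and>
     free_module (mpoly_ring\<lparr>carrier := polys_in Z\<rparr>) (M\<lparr>carrier := mult_space M u Z\<rparr>)"

text \<open>A pair \<open>(u, Z)\<close> encodes the Stanley space \<open>u K[Z]\<close>; the unique representation of every
  element expresses that \<open>M\<close> is the internal direct sum of these spaces. The zero module is free
  (of rank 0), so \<open>u = 0\<close> is not excluded; unless \<open>M = 0\<close>, omitting such summands gives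
  another Stanley decomposition, of at least the same depth.\<close>

definition stanley_decomposition ::
  "(('n, 'k::field) mpoly, 'm, 'e) module_scheme \<Rightarrow> (('n \<Rightarrow> int) \<Rightarrow> 'm set) \<Rightarrow>
    ('m \<times> 'n set) set \<Rightarrow> bool" where
  "stanley_decomposition M gr D \<longleftrightarrow>
     finite D \<and> (\<forall>(u, Z) \<in> D. stanley_space M gr u Z) \<and>
     (\<forall>x \<in> carrier M. \<exists>!f. f \<in> (\<Pi>\<^sub>E (u, Z) \<in> D. mult_space M u Z) \<and> finsum M f D = x)"

text \<open>
  The minimum and the maximum are taken in \<^typ>\<open>enat\<close> as infimum and supremum. Both are attained
  unless \<open>D\<close> is empty, which happens only for \<open>M = 0\<close>; then \<open>sdepth M = \<infinity>\<close>.
\<close>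

definition sdepth_decomposition :: "('m \<times> 'n set) set \<Rightarrow> enat" where
  "sdepth_decomposition D = (INF (u, Z) \<in> D. enat (card Z))"

definition sdepth ::
  "(('n, 'k::field) mpoly, 'm, 'e) module_scheme \<Rightarrow> (('n \<Rightarrow> int) \<Rightarrow> 'm set) \<Rightarrow> enat" where
  "sdepth M gr = (SUP D \<in> {D. stanley_decomposition M gr D}. sdepth_decomposition D)"

section \<open>The graded module \<open>S/J\<close>\<close>

definition quotient_module ::
  "('n, 'k::field) mpoly set \<Rightarrow> (('n, 'k) mpoly, ('n, 'k) mpoly set) module" where
  "quotient_module J = ring.extend (mpoly_ring Quot J)
     \<lparr>module.smult = (\<lambda>f x. (J +>\<^bsub>mpoly_ring\<^esub> f) \<otimes>\<^bsub>mpoly_ring Quot J\<^esub> x)\<rparr>"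

text \<open>The component of degree \<open>a\<close> of \<open>S\<close> is spanned by the monomial with exponent vector \<open>a\<close>
  (and is zero if \<open>a\<close> has a negative entry); \<open>S/J\<close> carries the induced grading for a monomial
  ideal \<open>J\<close>.\<close>

definition quotient_grading ::
  "('n, 'k::field) mpoly set \<Rightarrow> ('n \<Rightarrow> int) \<Rightarrow> ('n, 'k) mpoly set set" where
  "quotient_grading J a = (\<lambda>f. J +>\<^bsub>mpoly_ring\<^esub> f) `
     {f. \<forall>m \<in> Poly_Mapping.keys f. \<forall>i. int (Poly_Mapping.lookup m i) = a i}"

end

theory Submission
  imports Defs
begin

text \<open>
  For each bipartite component \<open>C\<close> and each monomial \<open>x\<^sup>m\<close> there is a variable in \<open>C\<close> all of whose
  powers can be multiplied into \<open>x\<^sup>m\<close> without increasing the number of edges of \<open>C\<close> that the monomial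
  contains: by weighted Koenig duality it is any vertex of \<open>C\<close> outside a minimum vertex cover.
  Choosing the first such variable in every bipartite component, in a fixed order of the variables,
  gives a set \<open>F m\<close> of \<open>p\<close> variables which does not change when a variable of \<open>F m\<close> is multiplied in.
  Since \<open>F m\<close> meets each of these components in a single variable, the exponents outside \<open>I\<^sup>k\<close> with the same set \<open>F\<close>
  and the same entries outside \<open>F\<close> form an orthant; truncation at \<open>2 k\<close> makes the number of
  orthants finite, and they are the Stanley spaces.
\<close>

subsection \<open>Edges contained in an exponent vector\<close>

text \<open>\<open>packs E n f\<close> says that \<open>x\<^sup>f\<close> is divisible by a product of \<open>n\<close> edge monomials.\<close>

primrec packs :: "('n \<times> 'n) set \<Rightarrow> nat \<Rightarrow> ('n \<Rightarrow> nat) \<Rightarrow> bool" where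
  "packs E 0 f \<longleftrightarrow> True"
| "packs E (Suc n) f \<longleftrightarrow> (\<exists>g i j. (i, j) \<in> E \<and> packs E n g \<and>
     (\<forall>v. g v + of_bool (v = i) + of_bool (v = j) \<le> f v))"

declare packs.simps(2) [simp del]

lemma packs_SucI:
  assumes "(i, j) \<in> E" "packs E n g" "\<And>v. g v + of_bool (v = i) + of_bool (v = j) \<le> f v"
  shows "packs E (Suc n) f"
  unfolding packs.simps(2) using assms by blast

lemma packs_SucE:
  assumes "packs E (Suc n) f"
  obtains g i j where "(i, j) \<in> E" "packs E n g"
    "\<And>v. g v + of_bool (v = i) + of_bool (v = j) \<le> f v"
  using assms unfolding packs.simps(2) by blast

text \<open>In the usual terminology of graph theory these are vertex covers.\<close>

definition edge_cover :: "('n \<times> 'n) set \<Rightarrow> 'n set \<Rightarrow> bool" where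
  "edge_cover E W \<longleftrightarrow> (\<forall>(i, j) \<in> E. i \<in> W \<or> j \<in> W)"

definition restr :: "'n set \<Rightarrow> ('n \<Rightarrow> nat) \<Rightarrow> 'n \<Rightarrow> nat" where
  "restr C f v = (if v \<in> C then f v else 0)"

lemma packs_mono:
  assumes "packs E n f" "\<And>v. f v \<le> g v" "E \<subseteq> E'"
  shows "packs E' n g"
  using assms(1,2)
proof (induction n arbitrary: f g)
  case (Suc n)
  then obtain h i j where h: "(i, j) \<in> E" "packs E n h"
    "\<And>v. h v + of_bool (v = i) + of_bool (v = j) \<le> f v"
    using packs_SucE by metis
  show ?case
  proof (rule packs_SucI)
    show "(i, j) \<in> E'"
      using h(1) assms(3) by blast
    show "packs E' n h"
      using Suc.IH[OF h(2)] by simp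
    show "h v + of_bool (v = i) + of_bool (v = j) \<le> g v" for v
      using h(3) Suc.prems(2) order_trans by blast
  qed
qed simp

lemma packs_Suc_D: "packs E (Suc n) f \<Longrightarrow> packs E n f"
proof (induction n arbitrary: f)
  case (Suc n)
  then obtain h i j where h: "(i, j) \<in> E" "packs E (Suc n) h"
    "\<And>v. h v + of_bool (v = i) + of_bool (v = j) \<le> f v"
    using packs_SucE by metis
  then show ?case
    using Suc.IH packs_SucI by metis
qed simp

lemma packs_antimono: "packs E n f \<Longrightarrow> m \<le> n \<Longrightarrow> packs E m f"
proof (induction "n - m" arbitrary: n)
  case (Suc d)
  then obtain n' where "n = Suc n'"
    by (cases n) auto
  with Suc show ?case
    using packs_Suc_D by (metis Suc_diff_le Suc_inject diff_Suc_Suc le_SucE nat.distinct(1) cancel_comm_monoid_add_class.diff_cancel)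
qed auto

lemma packs_add:
  assumes "packs E a f" "packs E b g"
  shows "packs E (a + b) (\<lambda>v. f v + g v)"
  using assms(1)
proof (induction a arbitrary: f)
  case 0
  then show ?case
    using packs_mono[OF assms(2)] by simp
next
  case (Suc a)
  then obtain h i j where h: "(i, j) \<in> E" "packs E a h"
    "\<And>v. h v + of_bool (v = i) + of_bool (v = j) \<le> f v"
    using packs_SucE by metis
  have "(h v + g v) + of_bool (v = i) + of_bool (v = j) \<le> f v + g v" for v
    using h(3)[of v] by linarith
  then show ?case
    using packs_SucI[OF h(1) Suc.IH[OF h(2)]] by simp
qed

text \<open>Weak duality: each packed edge takes at least one unit of weight inside the
  cover.\<close>

lemma packs_le_edge_cover:
  fixes f :: "'n::finite \<Rightarrow> nat"
  assumes "packs E n f" "edge_cover E W"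
  shows "n \<le> sum f W"
  using assms(1)
proof (induction n arbitrary: f)
  case (Suc n)
  then obtain h i j where h: "(i, j) \<in> E" "packs E n h"
    "\<And>v. h v + of_bool (v = i) + of_bool (v = j) \<le> f v"
    using packs_SucE by metis
  have "1 \<le> (\<Sum>v\<in>W. of_bool (v = i) + of_bool (v = j) :: nat)"
    using h(1) assms(2) unfolding edge_cover_def sum.distrib by (force simp: of_bool_def)
  then have "Suc n \<le> sum h W + (\<Sum>v\<in>W. of_bool (v = i) + of_bool (v = j) :: nat)"
    using Suc.IH[OF h(2)] by linarith
  also have "\<dots> = (\<Sum>v\<in>W. h v + of_bool (v = i) + of_bool (v = j))"
    by (simp add: sum.distrib)
  also have "\<dots> \<le> sum f W"
    using h(3) by (intro sum_mono)
  finally show ?case .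
qed simp

text \<open>One edge takes at most 2 units at a vertex (2 only for a loop, which \<open>E\<close>
  may contain here), so \<open>n\<close> edges never use more than \<open>2 * n\<close>
  there.\<close>

lemma packs_truncate:
  "packs E n f \<Longrightarrow> packs E n (\<lambda>v. min (f v) (2 * n))"
proof (induction n arbitrary: f)
  case (Suc n)
  then obtain h i j where h: "(i, j) \<in> E" "packs E n h"
    "\<And>v. h v + of_bool (v = i) + of_bool (v = j) \<le> f v"
    using packs_SucE by metis
  show ?case
  proof (rule packs_SucI[OF h(1) Suc.IH[OF h(2)]])
    show "min (h v) (2 * n) + of_bool (v = i) + of_bool (v = j) \<le> min (f v) (2 * Suc n)" for v
      using h(3)[of v] by (cases "v = i"; cases "v = j") auto
  qed
qed simp

lemma packs_truncate_iff:
  assumes "2 * n \<le> d"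
  shows "packs E n (\<lambda>v. min (f v) d) \<longleftrightarrow> packs E n f"
proof
  show "packs E n f" if "packs E n (\<lambda>v. min (f v) d)"
    using packs_mono[OF that, of f] by simp
  show "packs E n (\<lambda>v. min (f v) d)" if "packs E n f"
    using assms by (intro packs_mono[OF packs_truncate[OF that]]) auto
qed

text \<open>Every edge lies entirely within \<open>C\<close> or within its complement, so a packing
  sorts into edges of these two kinds.\<close>

lemma packs_split:
  assumes "packs E n f" and closed: "\<And>i j. (i, j) \<in> E \<Longrightarrow> i \<in> C \<longleftrightarrow> j \<in> C"
  shows "\<exists>a b. n = a + b \<and> packs E a (restr C f) \<and> packs E b (restr (- C) f)"
  using assms(1)
proof (induction n arbitrary: f)
  case (Suc n)
  then obtain h i j where h: "(i, j) \<in> E" "packs E n h"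
    "\<And>v. h v + of_bool (v = i) + of_bool (v = j) \<le> f v"
    using packs_SucE by metis
  obtain a b where ab: "n = a + b" "packs E a (restr C h)" "packs E b (restr (- C) h)"
    using Suc.IH[OF h(2)] by blast
  have le: "restr D h v \<le> restr D f v" for D v
    using h(3)[of v] by (simp add: restr_def)
  show ?case
  proof (cases "i \<in> C")
    case True
    have "restr C h v + of_bool (v = i) + of_bool (v = j) \<le> restr C f v" for v
      using h(3)[of v] True closed[OF h(1)] by (auto simp: restr_def)
    then have "packs E (Suc a) (restr C f)"
      using packs_SucI[OF h(1) ab(2)] by blast
    moreover have "packs E b (restr (- C) f)"
      using packs_mono[OF ab(3)] le by blast
    ultimately show ?thesis
      using ab(1) by (metis add_Suc)
  next
    case False
    have "restr (- C) h v + of_bool (v = i) + of_bool (v = j) \<le> restr (- C) f v" for v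
      using h(3)[of v] False closed[OF h(1)] by (auto simp: restr_def)
    then have "packs E (Suc b) (restr (- C) f)"
      using packs_SucI[OF h(1) ab(3)] by blast
    moreover have "packs E a (restr C f)"
      using packs_mono[OF ab(2)] le by blast
    ultimately show ?thesis
      using ab(1) by (metis add_Suc_right)
  qed
qed simp

text \<open>Weighted Koenig duality, by induction on the total weight. Either removing one edge from
  \<open>f\<close> lowers the minimum cover weight by at most 1, or some minimum cover contains both
  ends of that edge and splits the graph into two problems of smaller weight.\<close>

lemma bipartite_min_cover:
  fixes f :: "'n::finite \<Rightarrow> nat"
  assumes "A \<inter> B = {}" "E \<subseteq> A \<times> B \<union> B \<times> A"
  shows "\<exists>W. edge_cover E W \<and> packs E (sum f W) f"
proof (induction "sum f UNIV" arbitrary: f rule: less_induct)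
  case less
  obtain W where W: "edge_cover E W" and min: "\<And>S. edge_cover E S \<Longrightarrow> sum f W \<le> sum f S"
    using ex_has_least_nat[of "edge_cover E" UNIV "sum f"] by (auto simp: edge_cover_def)
  have "packs E (sum f W) f"
  proof (cases "\<exists>a b. (a, b) \<in> E \<and> f a > 0 \<and> f b > 0")
    case False
    \<comment> \<open>Every edge has an end of weight 0, so the zero set of \<open>f\<close> is a
      cover and the minimum is 0.\<close>
    then have "edge_cover E {v. f v = 0}"
      unfolding edge_cover_def by fastforce
    then have "sum f W \<le> sum f {v. f v = 0}"
      by (rule min)
    then show ?thesis
      by simp
  next
    case True
    then obtain a b where e: "(a, b) \<in> E" "f a > 0" "f b > 0"
      by auto
    have "a \<noteq> b"
      using e(1) assms by auto
    \<comment> \<open>\<open>f'\<close> is \<open>f\<close> with one copy of the edge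
      \<open>(a, b)\<close> removed; a packing in \<open>f'\<close> extends by this edge.\<close>
    define f' where "f' v = f v - of_bool (v = a) - of_bool (v = b)" for v
    have f': "f v = f' v + of_bool (v = a) + of_bool (v = b)" for v
      using e \<open>a \<noteq> b\<close> by (auto simp: f'_def)
    have sum_f: "sum f S = sum f' S + of_bool (a \<in> S) + of_bool (b \<in> S)" for S
      unfolding f' sum.distrib by (auto simp: of_bool_def)
    have "sum f' UNIV < sum f UNIV"
      using sum_f[of UNIV] by simp
    then obtain V where V: "edge_cover E V" "packs E (sum f' V) f'"
      using less by blast
    have "packs E (Suc (sum f' V)) f"
      using packs_SucI[OF e(1) V(2)] by (simp add: f')
    show ?thesis
    proof (cases "sum f W \<le> Suc (sum f' V)")
      case True
      with \<open>packs E (Suc (sum f' V)) f\<close> show ?thesis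
        using packs_antimono by blast
    next
      case False
      \<comment> \<open>Here \<open>sum f W\<close> is at least \<open>sum f' V + 2\<close>, while
        \<open>sum f V\<close> exceeds \<open>sum f' V\<close> by at most 2. Hence \<open>V\<close>
        contains both ends and is itself a minimum cover.\<close>
      have ab: "a \<in> V" "b \<in> V" and "sum f V \<le> sum f W"
        using False sum_f[of V] min[OF V(1)] by (auto simp: of_bool_def split: if_splits)
      then have fV: "sum f V = sum f W"
        using min[OF V(1)] by simp
      have ab_pos: "\<exists>x \<in> A \<inter> V. f x > 0" "\<exists>x \<in> B \<inter> V. f x > 0"
        using e ab assms(2) by auto
      \<comment> \<open>No edge joins \<open>A - V\<close> to \<open>B - V\<close>, so the two vertex-disjoint subgraphs on \<open>P\<close> and \<open>Q\<close>
        contain a maximum packing; both have smaller weight because \<open>V\<close> meets both sides of the support.\<close>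
      define P where "P = (A \<inter> V) \<union> (B - V)"
      define Q where "Q = (A - V) \<union> (B \<inter> V)"
      have restr_less: "sum (restr R f) UNIV < sum f UNIV" if "\<exists>x. x \<notin> R \<and> f x > 0" for R
        using that by (intro sum_strict_mono_ex1) (auto simp: restr_def)
      have sum_restr: "sum (restr R f) S = sum f (S \<inter> R)" for R S
        by (simp add: restr_def sum.inter_restrict)
      obtain S where S: "edge_cover E S" "packs E (sum (restr P f) S) (restr P f)"
        using less restr_less[of P] ab_pos(2) assms(1) unfolding P_def by blast
      obtain T where T: "edge_cover E T" "packs E (sum (restr Q f) T) (restr Q f)"
        using less restr_less[of Q] ab_pos(1) assms(1) unfolding Q_def by blast
      \<comment> \<open>An edge whose end in \<open>B\<close> is not in \<open>V\<close> has its
        other end in \<open>A \<inter> V\<close>, so it lies within \<open>P\<close> and is covered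
        by \<open>S\<close>.\<close>
      have "edge_cover E ((S \<inter> P) \<union> (B \<inter> V))" 
        using S(1) V(1) assms unfolding edge_cover_def P_def by blast
      then have "sum f W \<le> sum f ((S \<inter> P) \<union> (B \<inter> V))"
        by (rule min)
      also have "\<dots> \<le> sum f (S \<inter> P) + sum f (B \<inter> V)"
        by (simp add: sum_Un_nat)
      finally have 1: "sum f W \<le> sum (restr P f) S + sum f (B \<inter> V)"
        by (simp add: sum_restr)
      have "edge_cover E ((T \<inter> Q) \<union> (A \<inter> V))" 
        using T(1) V(1) assms unfolding edge_cover_def Q_def by blast
      then have "sum f W \<le> sum f ((T \<inter> Q) \<union> (A \<inter> V))"
        by (rule min)
      also have "\<dots> \<le> sum f (T \<inter> Q) + sum f (A \<inter> V)"
        by (simp add: sum_Un_nat)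
      finally have 2: "sum f W \<le> sum (restr Q f) T + sum f (A \<inter> V)"
        by (simp add: sum_restr)
      have "sum f (A \<inter> V) + sum f (B \<inter> V) = sum f ((A \<inter> V) \<union> (B \<inter> V))"
        using assms(1) by (subst sum.union_disjoint) auto
      also have "\<dots> \<le> sum f V"
        by (intro sum_mono2) auto
      \<comment> \<open>Adding bounds 1 and 2 gives \<open>2 * sum f W\<close> on the left; the term
        \<open>sum f V = sum f W\<close> on the right cancels one copy.\<close>
      finally have "sum f W \<le> sum (restr P f) S + sum (restr Q f) T"
        using 1 2 fV by linarith
      moreover have "packs E (sum (restr P f) S + sum (restr Q f) T) f"
        using assms(1) by (rule_tac packs_mono[OF packs_add[OF S(2) T(2)]]) (auto simp: restr_def P_def Q_def)
      ultimately show ?thesis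
        using packs_antimono by blast
    qed
  qed
  with W show ?case
    by blast
qed

subsection \<open>Partitions into orthants\<close>

text \<open>The exponents of the monomials in the Stanley space \<open>x^u K[Z]\<close>.\<close>

definition cone :: "('n \<Rightarrow> nat) \<Rightarrow> 'n set \<Rightarrow> ('n \<Rightarrow> nat) set" where
  "cone u Z = {m. (\<forall>v. u v \<le> m v) \<and> (\<forall>v. v \<notin> Z \<longrightarrow> m v = u v)}"

text \<open>Members of \<open>N\<close> are classed by \<open>F m\<close> and by their truncated
  entries outside \<open>F m\<close>. By \<open>meet\<close> each class has a least vector
  \<open>u\<close>, with entries at most \<open>d\<close>; by \<open>step\<close> the class is the
  orthant above \<open>u\<close>. Its directions include those with \<open>u v = d\<close>, since
  neither \<open>N\<close> nor \<open>F\<close> distinguishes larger entries from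
  \<open>d\<close>.\<close>

lemma cone_partition:
  fixes N :: "('n::finite \<Rightarrow> nat) set" and F :: "('n \<Rightarrow> nat) \<Rightarrow> 'n set"
  assumes truncN: "\<And>m. (\<lambda>v. min (m v) d) \<in> N \<longleftrightarrow> m \<in> N"
    and truncF: "\<And>m. F (\<lambda>v. min (m v) d) = F m"
    and step: "\<And>m v. m \<in> N \<Longrightarrow> v \<in> F m \<Longrightarrow>
      m(v := Suc (m v)) \<in> N \<and> F (m(v := Suc (m v))) = F m"
    and meet: "\<And>m m'. m \<in> N \<Longrightarrow> m' \<in> N \<Longrightarrow> F m = F m' \<Longrightarrow> (\<And>v. v \<notin> F m \<Longrightarrow> m v = m' v) \<Longrightarrow>
      (\<lambda>v. min (m v) (m' v)) \<in> N \<and> F (\<lambda>v. min (m v) (m' v)) = F m"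
  shows "\<exists>L. finite L \<and> N = (\<Union>u\<in>L. cone u ({v. u v = d} \<union> F u)) \<and>
    disjoint_family_on (\<lambda>u. cone u ({v. u v = d} \<union> F u)) L"
proof -
  \<comment> \<open>Iterates \<open>step\<close>: \<open>m'\<close> is reached by raising one
    coordinate in \<open>F m\<close> at a time, with induction on the remaining total
    difference.\<close>
  have up: "m' \<in> N \<and> F m' = F m"
    if "m \<in> N" "\<And>v. m v \<le> m' v" "\<And>v. v \<notin> F m \<Longrightarrow> m' v = m v" for m m'
    using that
  proof (induction "sum m' UNIV - sum m UNIV" arbitrary: m rule: less_induct)
    case less
    show ?case
    proof (cases "m = m'")
      case False
      then obtain v where "m v \<noteq> m' v"
        by blast
      then have v: "m v < m' v" "v \<in> F m"
        using less.prems(2)[of v] less.prems(3)[of v] by (simp, metis)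
      let ?n = "m(v := Suc (m v))"
      have n: "?n \<in> N" "F ?n = F m"
        using step less.prems(1) v(2) by blast+
      have le: "?n w \<le> m' w" for w
        using less.prems(2) v(1) by auto
      have "sum m UNIV < sum ?n UNIV"
        by (intro sum_strict_mono_ex1) auto
      moreover have "sum ?n UNIV \<le> sum m' UNIV"
        using le by (rule sum_mono)
      ultimately have "m' \<in> N \<and> F m' = F ?n"
        using n less.prems v le by (intro less.hyps) auto
      then show ?thesis
        using n by simp
    qed (use less in auto)
  qed
  \<comment> \<open>These are the members of the class of \<open>m\<close> whose entries outside
    \<open>F m\<close> are already cut at \<open>d\<close>.\<close>
  define cand where "cand m = {m'. m' \<in> N \<and> F m' = F m \<and> (\<forall>v. v \<notin> F m \<longrightarrow> m' v = min (m v) d)}" for m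
  have trunc_cand: "(\<lambda>v. min (m v) d) \<in> cand m" if "m \<in> N" for m
    using that truncN truncF by (simp add: cand_def)
  have least: "\<exists>u. u \<in> cand m \<and> (\<forall>m'\<in>cand m. \<forall>v. u v \<le> m' v)" if "m \<in> N" for m
  proof -
    note m = trunc_cand[OF \<open>m \<in> N\<close>]
    \<comment> \<open>A candidate of least total is least in every coordinate: otherwise its minimum
      with a candidate smaller at \<open>v\<close> would be a candidate of smaller total.\<close>
    obtain u where u: "u \<in> cand m" and min: "\<And>m'. m' \<in> cand m \<Longrightarrow> sum u UNIV \<le> sum m' UNIV"
      using ex_has_least_nat[of "\<lambda>u. u \<in> cand m" _ "\<lambda>u. sum u UNIV"] m by blast
    have "u v \<le> m' v" if m': "m' \<in> cand m" for m' v
    proof (rule ccontr)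
      assume *: "\<not> u v \<le> m' v"
      let ?i = "\<lambda>v. min (u v) (m' v)"
      have "?i \<in> N \<and> F ?i = F u"
        using u m' by (intro meet) (auto simp: cand_def)
      then have "?i \<in> cand m"
        using u m' by (auto simp: cand_def)
      then have "sum u UNIV \<le> sum ?i UNIV"
        by (rule min)
      moreover have "sum ?i UNIV < sum u UNIV"
        using * by (intro sum_strict_mono_ex1) (auto intro!: exI[of _ v])
      ultimately show False
        by simp
    qed
    with u show ?thesis
      by blast
  qed
  \<comment> \<open>The choice depends on \<open>m\<close> only through \<open>cand m\<close>, so
    all members of one class receive the same vector.\<close>
  define c where "c m = (SOME u. u \<in> cand m \<and> (\<forall>m'\<in>cand m. \<forall>v. u v \<le> m' v))" for m
  have c: "c m \<in> cand m" "m' \<in> cand m \<Longrightarrow> c m v \<le> m' v" if "m \<in> N" for m m' v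
    using someI_ex[OF least[OF that]] unfolding c_def by blast+
  have c_le: "c m v \<le> m v" "c m v \<le> d" if "m \<in> N" for m v
    using c(2)[OF that trunc_cand[OF that], of v] by simp_all
  let ?Z = "\<lambda>u. {v. u v = d} \<union> F u"
  have in_cone: "m \<in> cone (c m) (?Z (c m))" if "m \<in> N" for m
    using c(1)[OF that] c_le(1)[OF that] unfolding cone_def cand_def by (auto simp: min_def split: if_splits)
  \<comment> \<open>Together with \<open>in_cone\<close>, this identifies the cones with the fibres
    of \<open>c\<close> on \<open>N\<close>, which yields both the union and the
    disjointness.\<close>
  have cone_fiber: "m \<in> N \<and> c m = c m0" if "m0 \<in> N" and m: "m \<in> cone (c m0) (?Z (c m0))" for m m0
  proof -
    let ?t = "\<lambda>v. min (m v) d"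
    have c0: "c m0 \<in> N" "F (c m0) = F m0" "\<And>v. v \<notin> F m0 \<Longrightarrow> c m0 v = min (m0 v) d"
      using c(1)[OF \<open>m0 \<in> N\<close>] by (auto simp: cand_def)
    have t: "?t v = c m0 v" if "v \<notin> F m0" for v
      using m that c0(2) c_le(2)[OF \<open>m0 \<in> N\<close>, of v] unfolding cone_def by (cases "c m0 v = d") (auto simp: min_absorb2)
    have "?t \<in> N \<and> F ?t = F (c m0)"
    proof (rule up)
      show "c m0 v \<le> ?t v" for v
        using m c_le(2)[OF \<open>m0 \<in> N\<close>] by (auto simp: cone_def)
    qed (use c0 t in auto)
    then have *: "m \<in> N" "F m = F m0"
      using truncN truncF c0 by auto
    then have "cand m = cand m0"
      using t c0(3) unfolding cand_def by auto
    then show ?thesis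
      using * by (simp add: c_def)
  qed
  have "c ` N \<subseteq> (UNIV :: 'n set) \<rightarrow>\<^sub>E {..d}"
    using c_le(2) by auto
  then have "finite (c ` N)"
    by (rule finite_subset) (simp add: finite_PiE)
  moreover have "N = (\<Union>u\<in>c ` N. cone u (?Z u))"
    using in_cone cone_fiber by blast
  moreover have "disjoint_family_on (\<lambda>u. cone u (?Z u)) (c ` N)"
    unfolding disjoint_family_on_def
  proof (intro ballI impI equals0I)
    fix u u' m
    assume u: "u \<in> c ` N" "u' \<in> c ` N" "u \<noteq> u'" "m \<in> cone u (?Z u) \<inter> cone u' (?Z u')"
    then obtain m0 m1 where "m0 \<in> N" "u = c m0" "m1 \<in> N" "u' = c m1"
      by blast
    then show False
      using cone_fiber[of m0 m] cone_fiber[of m1 m] u(3,4) by simp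
  qed
  ultimately show ?thesis
    by blast
qed

section \<open>Free vertices of a component\<close>

text \<open>The vertices of \<open>C\<close> whose variable can be multiplied in arbitrarily often without increasing
  the number of edges contained in the part of the monomial that lives on \<open>C\<close>, as long as this number is at most \<open>k\<close>.\<close>

definition free_at :: "('n \<times> 'n) set \<Rightarrow> nat \<Rightarrow> 'n set \<Rightarrow> ('n \<Rightarrow> nat) \<Rightarrow> 'n set" where
  "free_at E k C m = {v \<in> C. \<forall>t. \<forall>j\<le>k. packs E j (restr C (m(v := m v + t))) \<longrightarrow> packs E j (restr C m)}"

lemma restr_cong: "(\<And>v. v \<in> C \<Longrightarrow> m v = m' v) \<Longrightarrow> restr C m = restr C m'"
  by (auto simp: restr_def)

lemma free_at_cong:
  assumes "\<And>v. v \<in> C \<Longrightarrow> m v = m' v"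
  shows "free_at E k C m = free_at E k C m'"
proof -
  have "restr C (m(v := m v + t)) = restr C (m'(v := m' v + t))" if "v \<in> C" for v t
    using assms that by (intro restr_cong) auto
  moreover have "restr C m = restr C m'"
    using assms by (rule restr_cong)
  ultimately show ?thesis
    unfolding free_at_def by auto
qed

text \<open>Only packings of at most \<open>k\<close> edges enter \<open>free_at\<close>, and these
  use at most \<open>2 * k\<close> at each vertex.\<close>

lemma free_at_truncate: "free_at E k C (\<lambda>v. min (m v) (2 * k)) = free_at E k C m"
proof -
  let ?t = "\<lambda>m v. min (m v) (2 * k) :: nat"
  have restr: "restr C (?t m) = ?t (restr C m)" for m
    by (auto simp: restr_def)
  have 1: "packs E j (restr C (?t m)) \<longleftrightarrow> packs E j (restr C m)" if "j \<le> k" for j m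
    unfolding restr using that by (intro packs_truncate_iff) simp
  \<comment> \<open>Truncating after raising \<open>v\<close> gives at most what truncating before
    raising it gives.\<close>
  have 2: "packs E j (restr C ((?t m)(v := ?t m v + t))) \<longleftrightarrow> packs E j (restr C (m(v := m v + t)))"
    (is "packs E j ?l \<longleftrightarrow> packs E j ?r") if "j \<le> k" for j v t
  proof
    show "packs E j ?r" if "packs E j ?l"
      using that by (rule packs_mono) (auto simp: restr_def)
    assume "packs E j ?r"
    then have "packs E j (restr C (?t (m(v := m v + t))))"
      using 1[OF that] by blast
    then show "packs E j ?l"
      by (rule packs_mono) (auto simp: restr_def)
  qed
  show ?thesis
    unfolding free_at_def using 1 2 by auto
qed

text \<open>A further raise of \<open>v\<close> is just a larger raise from \<open>m\<close>, so
  \<open>v\<close> stays free. A vertex free after the raise was free before: a packing is brought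
  back by the freeness of that vertex and then by that of \<open>v\<close>. Hence the first free
  vertex, when raised, remains the first.\<close>

lemma free_at_incr:
  assumes "v \<in> free_at E k C m"
  shows "v \<in> free_at E k C (m(v := Suc (m v)))"
    and "free_at E k C (m(v := Suc (m v))) \<subseteq> free_at E k C m"
proof -
  let ?m = "m(v := Suc (m v))"
  have v: "packs E j (restr C m)" if "packs E j (restr C (m(v := m v + t)))" "j \<le> k" for t j
    using assms that by (auto simp: free_at_def)
  have le: "restr C m w \<le> restr C ?m w" for w
    by (simp add: restr_def)
  show "v \<in> free_at E k C ?m"
    unfolding free_at_def
  proof (intro CollectI conjI allI impI)
    fix t j assume "j \<le> k" "packs E j (restr C (?m(v := ?m v + t)))"
    then have "packs E j (restr C m)"
      using v[of j "Suc t"] by simp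
    then show "packs E j (restr C ?m)"
      by (rule packs_mono) (simp_all add: le)
  qed (use assms in \<open>auto simp: free_at_def\<close>)
  show "free_at E k C ?m \<subseteq> free_at E k C m"
  proof
    fix w assume w: "w \<in> free_at E k C ?m"
    have "packs E j (restr C m)" if "j \<le> k" "packs E j (restr C (m(w := m w + t)))" for t j
    proof -
      have "packs E j (restr C (?m(w := ?m w + t)))"
        using that(2) by (rule packs_mono) (auto simp: restr_def)
      then have "packs E j (restr C ?m)"
        using w that(1) by (auto simp: free_at_def)
      then show ?thesis
        using v[of j 1] that(1) by simp
    qed
    with w show "w \<in> free_at E k C m"
      by (auto simp: free_at_def)
  qed
qed

text \<open>The part of a packing inside \<open>C\<close> already fits into \<open>m\<close> by the
  freeness of \<open>v\<close>; the part outside \<open>C\<close> does not see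
  \<open>v\<close>.\<close>

lemma not_packs_incr:
  assumes closed: "\<And>i j. (i, j) \<in> E \<Longrightarrow> i \<in> C \<longleftrightarrow> j \<in> C"
    and "v \<in> free_at E k C m" "\<not> packs E k m"
  shows "\<not> packs E k (m(v := Suc (m v)))"
proof
  let ?m = "m(v := Suc (m v))"
  assume "packs E k ?m"
  then obtain a b where ab: "k = a + b" "packs E a (restr C ?m)" "packs E b (restr (- C) ?m)"
    using packs_split[of E k ?m C] closed by blast
  have v: "v \<in> C" "packs E a (restr C m)"
    using assms(2) ab(1) ab(2) by (auto simp: free_at_def dest: spec[of _ 1])
  have "restr (- C) ?m = restr (- C) m"
    using v(1) by (intro restr_cong) auto
  then have "packs E b (restr (- C) m)"
    using ab(3) by metis
  then have "packs E k m"
    unfolding ab(1) by (rule packs_mono[OF packs_add[OF v(2)]]) (auto simp: restr_def)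
  then show False
    using assms(3) by blast
qed

text \<open>A vertex outside a cover of minimum weight is free: its weight does not enter the bound
  of \<open>packs_le_edge_cover\<close>, and the packing from \<open>bipartite_min_cover\<close>
  already attains that bound.\<close>

lemma free_at_nonempty:
  fixes E :: "('n::finite \<times> 'n) set"
  assumes "bipartite_on E C" "C \<noteq> {}"
    and closed: "\<And>i j. (i, j) \<in> E \<Longrightarrow> i \<in> C \<longleftrightarrow> j \<in> C"
  shows "free_at E k C m \<noteq> {}"
proof -
  let ?E = "E \<inter> C \<times> C"
  obtain A B where AB: "A \<union> B = C" "A \<inter> B = {}"
    and sides: "\<forall>(i, j) \<in> ?E. (i \<in> A \<and> j \<in> B) \<or> (i \<in> B \<and> j \<in> A)"
    using assms(1) unfolding bipartite_on_def by (elim exE conjE) (rule that)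
  have E_sub: "?E \<subseteq> A \<times> B \<union> B \<times> A"
    using sides by fast
  obtain W where W: "edge_cover ?E W" "packs ?E (sum (restr C m) W) (restr C m)"
    using bipartite_min_cover[OF AB(2) E_sub] by blast
  \<comment> \<open>If \<open>W\<close> contains all of \<open>C\<close>, one of the sides
    \<open>A\<close>, \<open>B\<close> replaces it: each is a cover of no greater weight, and they
    cannot both contain the nonempty set \<open>C\<close>.\<close>
  have "\<exists>V. edge_cover ?E V \<and> \<not> C \<subseteq> V \<and> sum (restr C m) V \<le> sum (restr C m) W"
  proof (cases "C \<subseteq> W")
    case True
    have cover: "edge_cover ?E A" "edge_cover ?E B"
      using sides unfolding edge_cover_def by fast+
    have "A \<subseteq> W" "B \<subseteq> W" "\<not> C \<subseteq> A \<or> \<not> C \<subseteq> B"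
      using AB(1,2) assms(2) True by blast+
    then have "sum (restr C m) A \<le> sum (restr C m) W" "sum (restr C m) B \<le> sum (restr C m) W"
      by (simp_all add: sum_mono2)
    then show ?thesis
      using cover \<open>\<not> C \<subseteq> A \<or> \<not> C \<subseteq> B\<close> by blast
  qed (use W in blast)
  then obtain V v where V: "edge_cover ?E V" "v \<in> C" "v \<notin> V"
    "sum (restr C m) V \<le> sum (restr C m) W"
    by blast
  have "packs E j (restr C m)" if "packs E j (restr C (m(v := m v + t)))" for j t
  proof -
    \<comment> \<open>The vertices outside \<open>C\<close> extend \<open>V\<close> to a cover of
      all of \<open>E\<close> and add no weight, since \<open>restr\<close> vanishes on
      them.\<close>
    have "edge_cover E (V \<union> - C)"
      using V(1) unfolding edge_cover_def by blast
    then have "j \<le> sum (restr C (m(v := m v + t))) (V \<union> - C)"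
      using that packs_le_edge_cover by blast
    also have "\<dots> = sum (restr C m) (V \<union> - C)"
      using V(2,3) by (intro sum.cong) (auto simp: restr_def)
    also have "\<dots> = sum (restr C m) V"
      by (intro sum.mono_neutral_right) (auto simp: restr_def)
    finally have "j \<le> sum (restr C m) W"
      using V(4) by simp
    then have "packs ?E j (restr C m)"
      using W(2) packs_antimono by blast
    then show ?thesis
      by (rule packs_mono) auto
  qed
  then show ?thesis
    using V(2) unfolding free_at_def by blast
qed

section \<open>The orthants outside the power of the edge ideal\<close>

lemma components_closed:
  assumes "sym E" "C \<in> components E" "(i, j) \<in> E"
  shows "i \<in> C \<longleftrightarrow> j \<in> C"
proof -
  obtain x where C: "C = E\<^sup>* `` {x}"
    using assms(2) unfolding components_def by (auto elim: quotientE)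
  show ?thesis
    using assms(1,3) unfolding C by (auto intro: rtrancl_into_rtrancl dest: symD)
qed

lemma equiv_rtrancl: "sym E \<Longrightarrow> equiv UNIV (E\<^sup>*)"
  by (intro equivI) (auto simp: refl_rtrancl sym_rtrancl trans_rtrancl)

text \<open>Instance of \<open>cone_partition\<close> with \<open>d = 2 * k\<close>, where
  \<open>F m\<close> consists of the first free vertex of each bipartite component.\<close>

lemma not_packs_cones:
  fixes E :: "('n::finite \<times> 'n) set"
  assumes "sym E"
  defines "p \<equiv> card {C \<in> components E. bipartite_on E C}"
  shows "\<exists>L Z. finite L \<and> (\<forall>u\<in>L. p \<le> card (Z u)) \<and>
    {m. \<not> packs E k m} = (\<Union>u\<in>L. cone u (Z u)) \<and> disjoint_family_on (\<lambda>u. cone u (Z u)) L"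
proof -
  let ?B = "{C \<in> components E. bipartite_on E C}"
  let ?N = "{m. \<not> packs E k m}"
  have equiv: "equiv UNIV (E\<^sup>*)"
    using assms(1) by (rule equiv_rtrancl)
  have nonempty: "C \<noteq> {}" if "C \<in> ?B" for C
    using that in_quotient_imp_non_empty[OF equiv] by (auto simp: components_def)
  have disj: "C = D" if "C \<in> ?B" "D \<in> ?B" "v \<in> C" "v \<in> D" for C D v
    using that quotient_disj[OF equiv, of C D] by (auto simp: components_def)
  have closed: "i \<in> C \<longleftrightarrow> j \<in> C" if "C \<in> ?B" "(i, j) \<in> E" for C i j
    using components_closed[OF assms(1)] that by blast
  \<comment> \<open>\<open>h\<close> fixes the order of the vertices that decides which free vertex
    is first.\<close>
  obtain h :: "'n \<Rightarrow> nat" where "inj h"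
    using finite_imp_inj_to_nat_seg[OF finite_class.finite_UNIV] by blast
  define fv where "fv C m = (ARG_MIN h v. v \<in> free_at E k C m)" for C m
  have fv_free: "fv C m \<in> free_at E k C m" 
    and fv_least: "\<And>w. w \<in> free_at E k C m \<Longrightarrow> h (fv C m) \<le> h w" if "C \<in> ?B" for C m
  proof -
    have "free_at E k C m \<noteq> {}"
      using that nonempty[OF that] closed[OF that] by (intro free_at_nonempty) auto
    then obtain v where "v \<in> free_at E k C m"
      by blast
    note arg_min_nat_lemma[of "\<lambda>v. v \<in> free_at E k C m", OF this, of h]
    then show "fv C m \<in> free_at E k C m" "\<And>w. w \<in> free_at E k C m \<Longrightarrow> h (fv C m) \<le> h w"
      unfolding fv_def by blast+
  qed
  have fv_C: "fv C m \<in> C" if "C \<in> ?B" for C m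
    using fv_free[OF that] by (auto simp: free_at_def)
  have fv_cong: "fv C m = fv C m'" if "\<And>v. v \<in> C \<Longrightarrow> m v = m' v" for C m m'
    unfolding fv_def using free_at_cong[of C m m'] that by simp
  have fv_incr: "fv C (m(fv C m := Suc (m (fv C m)))) = fv C m" if "C \<in> ?B" for C m
  proof -
    let ?m = "m(fv C m := Suc (m (fv C m)))"
    have "h (fv C ?m) = h (fv C m)"
    proof (rule order_antisym)
      show "h (fv C ?m) \<le> h (fv C m)"
        by (intro fv_least that free_at_incr(1) fv_free)
      show "h (fv C m) \<le> h (fv C ?m)"
        using free_at_incr(2)[OF fv_free[OF that]] fv_free[OF that, of ?m]
        by (intro fv_least that) blast
    qed
    then show ?thesis
      using \<open>inj h\<close> by (simp add: inj_eq)
  qed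
  define F where "F m = (\<lambda>C. fv C m) ` ?B" for m
  have F_Int: "v = fv C m" if "C \<in> ?B" "v \<in> F m" "v \<in> C" for C m v
  proof -
    note F = that
    obtain D where D: "D \<in> ?B" "v = fv D m"
      using F(2) unfolding F_def by blast
    then have "D = C"
      using disj[OF D(1) F(1) fv_C[OF D(1)]] F(3) D(2) by simp
    then show ?thesis
      using D(2) by simp
  qed
  have "inj_on (\<lambda>C. fv C m) ?B" for m
  proof (rule inj_onI)
    fix C D assume *: "C \<in> ?B" "D \<in> ?B" "fv C m = fv D m"
    show "C = D"
      using disj[OF *(1,2) fv_C[OF *(1), of m]] fv_C[OF *(2), of m] *(3) by simp
  qed
  then have card_F: "card (F m) = p" for m
    unfolding F_def p_def by (rule card_image)
  have "\<exists>L. finite L \<and> ?N = (\<Union>u\<in>L. cone u ({v. u v = 2 * k} \<union> F u)) \<and>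
    disjoint_family_on (\<lambda>u. cone u ({v. u v = 2 * k} \<union> F u)) L"
  proof (rule cone_partition)
    show "(\<lambda>v. min (m v) (2 * k)) \<in> ?N \<longleftrightarrow> m \<in> ?N" for m
      using packs_truncate_iff by auto
    show "F (\<lambda>v. min (m v) (2 * k)) = F m" for m
      unfolding F_def fv_def free_at_truncate ..
  next
    fix m v assume "m \<in> ?N" "v \<in> F m"
    then obtain C where C: "C \<in> ?B" "v = fv C m"
      by (auto simp: F_def)
    let ?m = "m(v := Suc (m v))"
    have "?m \<in> ?N"
      using not_packs_incr[OF closed[OF C(1)]] fv_free[OF C(1)] C(2) \<open>m \<in> ?N\<close> by auto
    moreover have "fv D ?m = fv D m" if "D \<in> ?B" for D
    proof (cases "D = C")
      case False
      then have "v \<notin> D"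
        using disj[OF that C(1)] fv_C[OF C(1)] C(2) by blast
      then show ?thesis
        by (intro fv_cong) auto
    qed (use fv_incr[OF C(1)] C(2) in simp)
    ultimately show "?m \<in> ?N \<and> F ?m = F m"
      unfolding F_def by auto
  next
    fix m m' assume mm': "m \<in> ?N" "m' \<in> ?N" "F m = F m'" "\<And>v. v \<notin> F m \<Longrightarrow> m v = m' v"
    let ?i = "\<lambda>v. min (m v) (m' v)"
    have "?i \<in> ?N"
      using mm'(1) packs_mono[of E k ?i m] by auto
    moreover have "fv C ?i = fv C m" if C: "C \<in> ?B" for C
    proof -
      have eq: "fv C m' = fv C m"
        using F_Int[OF C, of "fv C m'" m] fv_C[OF C] mm'(3) C by (auto simp: F_def)
      \<comment> \<open>\<open>fv C m\<close> is the only vertex of \<open>C\<close> in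
        \<open>F m\<close>, so on \<open>C\<close> the two vectors differ in at most one coordinate,
        and their minimum coincides there with one of them.\<close>
      have off: "m v = m' v" if "v \<in> C" "v \<noteq> fv C m" for v
        using F_Int[OF C] mm'(4) that by blast
      show ?thesis
      proof (cases "m (fv C m) \<le> m' (fv C m)")
        case True
        have "?i v = m v" if "v \<in> C" for v
          using off[OF that] True by (cases "v = fv C m") auto
        then show ?thesis
          by (rule fv_cong)
      next
        case False
        have "?i v = m' v" if "v \<in> C" for v
          using off[OF that] False by (cases "v = fv C m") auto
        then show ?thesis
          unfolding eq[symmetric] by (rule fv_cong)
      qed
    qed
    ultimately show "?i \<in> ?N \<and> F ?i = F m"
      unfolding F_def by auto
  qed
  then obtain L where L: "finite L" "?N = (\<Union>u\<in>L. cone u ({v. u v = 2 * k} \<union> F u))"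
    "disjoint_family_on (\<lambda>u. cone u ({v. u v = 2 * k} \<union> F u)) L"
    by blast
  have "p \<le> card ({v. u v = 2 * k} \<union> F u)" for u
    using card_mono[of "{v. u v = 2 * k} \<union> F u" "F u"] card_F by simp
  with L show ?thesis
    by (intro exI[of _ L] exI[of _ "\<lambda>u. {v. u v = 2 * k} \<union> F u"]) auto
qed

subsection \<open>Powers of the edge ideal\<close>

lemma mpoly_ring_simps [simp]:
  "carrier mpoly_ring = (UNIV :: ('n, 'k::field) mpoly set)"
  "(f :: ('n, 'k) mpoly) \<otimes>\<^bsub>mpoly_ring\<^esub> g = f * g"
  "(f :: ('n, 'k) mpoly) \<oplus>\<^bsub>mpoly_ring\<^esub> g = f + g"
  "\<one>\<^bsub>mpoly_ring\<^esub> = (1 :: ('n, 'k) mpoly)"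
  "\<zero>\<^bsub>mpoly_ring\<^esub> = (0 :: ('n, 'k) mpoly)"
  by (simp_all add: ring_of_type_algebra_def)

lemma cring_mpoly_ring: "cring (mpoly_ring :: ('n, 'k::field) mpoly ring)"
  by (rule cring_from_type_algebra)

lemma ring_mpoly_ring: "ring (mpoly_ring :: ('n, 'k::field) mpoly ring)"
  using cring_mpoly_ring by (rule cring.axioms)

section \<open>Subspaces spanned by monomials\<close>

definition supported_on :: "('n \<Rightarrow>\<^sub>0 nat) set \<Rightarrow> ('n, 'k::field) mpoly set" where
  "supported_on U = {f. Poly_Mapping.keys f \<subseteq> U}"

lemma supported_on_iff: "f \<in> supported_on U \<longleftrightarrow> (\<forall>m. m \<notin> U \<longrightarrow> Poly_Mapping.lookup f m = 0)"
  by (auto simp: supported_on_def in_keys_iff)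

lemma supported_on_closed:
  "0 \<in> supported_on U"
  "f \<in> supported_on U \<Longrightarrow> g \<in> supported_on U \<Longrightarrow> f + g \<in> supported_on U"
  "f \<in> supported_on U \<Longrightarrow> - f \<in> supported_on U"
  "f \<in> supported_on U \<Longrightarrow> g \<in> supported_on U \<Longrightarrow> f - g \<in> supported_on U"
  by (simp_all add: supported_on_iff lookup_add lookup_minus)

lemma supported_on_mult:
  assumes "f \<in> supported_on A" "g \<in> supported_on B" "\<And>a b. a \<in> A \<Longrightarrow> b \<in> B \<Longrightarrow> a + b \<in> C"
  shows "f * g \<in> supported_on C"
  using keys_mult[of f g] assms unfolding supported_on_def by fast

lemma supported_on_UNIV: "supported_on UNIV = UNIV"
  by (simp add: supported_on_def)

lemma poly_mapping_sum_single:
  fixes f :: "'a \<Rightarrow>\<^sub>0 'b::comm_monoid_add"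
  shows "(\<Sum>m\<in>Poly_Mapping.keys f. Poly_Mapping.single m (Poly_Mapping.lookup f m)) = f"
  by (rule poly_mapping_eqI) (simp add: lookup_sum lookup_single when_def in_keys_iff)

lemma lookup_mult_single:
  fixes f :: "('n, 'k::field) mpoly"
  shows "Poly_Mapping.lookup (f * Poly_Mapping.single a 1) (m + a) = Poly_Mapping.lookup f m"
proof -
  have "f * Poly_Mapping.single a 1 =
    (\<Sum>b\<in>Poly_Mapping.keys f. Poly_Mapping.single (b + a) (Poly_Mapping.lookup f b))"
    by (subst (1) poly_mapping_sum_single[of f, symmetric]) (simp add: sum_distrib_right mult_single)
  then show ?thesis
    by (simp add: lookup_sum lookup_single when_def in_keys_iff)
qed

lemma ideal_supported_on:
  assumes up: "\<And>m r. m \<in> U \<Longrightarrow> r + m \<in> U"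
  shows "ideal (supported_on U :: ('n, 'k::field) mpoly set) mpoly_ring"
proof (rule idealI[OF ring_mpoly_ring])
  interpret R: cring "mpoly_ring :: ('n, 'k) mpoly ring"
    by (rule cring_mpoly_ring)
  have inv: "inv\<^bsub>add_monoid mpoly_ring\<^esub> f = - f" for f :: "('n, 'k) mpoly"
    using R.add.inv_equality[of "- f" f] by (simp add: a_inv_def)
  show "subgroup (supported_on U :: ('n, 'k) mpoly set) (add_monoid mpoly_ring)"
    by (rule subgroup.intro; (unfold inv)?; simp add: supported_on_closed)
  show "x \<otimes>\<^bsub>mpoly_ring\<^esub> f \<in> supported_on U" if "f \<in> supported_on U" for f x :: "('n, 'k) mpoly"
    using that up supported_on_mult[of x UNIV f U U] by (simp add: supported_on_UNIV)
  then show "f \<otimes>\<^bsub>mpoly_ring\<^esub> x \<in> supported_on U" if "f \<in> supported_on U" for f x :: "('n, 'k) mpoly"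
    using that by (simp add: mult.commute)
qed

text \<open>Every polynomial is the finite sum of its terms, so sums of single terms reach the whole
  span.\<close>

lemma supported_on_subset:
  fixes H :: "('n, 'k::field) mpoly set"
  assumes "0 \<in> H" "\<And>f g. f \<in> H \<Longrightarrow> g \<in> H \<Longrightarrow> f + g \<in> H"
    and "\<And>m c. m \<in> U \<Longrightarrow> Poly_Mapping.single m c \<in> H"
  shows "supported_on U \<subseteq> H"
proof
  fix f :: "('n, 'k) mpoly" assume f: "f \<in> supported_on U"
  have "(\<Sum>m\<in>A. Poly_Mapping.single m (Poly_Mapping.lookup f m)) \<in> H" if "finite A" "A \<subseteq> U" for A
    using that by (induction A rule: finite_induct) (use assms in auto)
  from this[of "Poly_Mapping.keys f"] show "f \<in> H"
    using f unfolding poly_mapping_sum_single by (simp add: supported_on_def)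
qed

section \<open>Exponents of the monomials in the powers of the edge ideal\<close>

definition packing_exponents :: "('n \<times> 'n) set \<Rightarrow> nat \<Rightarrow> ('n \<Rightarrow>\<^sub>0 nat) set" where
  "packing_exponents E n = {m. packs E n (Poly_Mapping.lookup m)}"

lemma packing_exponents_up: "m \<in> packing_exponents E n \<Longrightarrow> r + m \<in> packing_exponents E n"
  unfolding packing_exponents_def by (auto simp: lookup_add elim: packs_mono)

text \<open>\<open>packs\<close> lets the packed edges leave a remainder; absorbing it into
  \<open>m\<close> makes the factorisation exact.\<close>

lemma packing_exponents_Suc:
  "packing_exponents E (Suc n) =
    {m + (Poly_Mapping.single i 1 + Poly_Mapping.single j 1) | m i j. m \<in> packing_exponents E n \<and> (i, j) \<in> E}"
proof (intro Set.set_eqI iffI)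
  fix m assume "m \<in> packing_exponents E (Suc n)"
  then obtain g i j where g: "(i, j) \<in> E" "packs E n g"
    "\<And>v. g v + of_bool (v = i) + of_bool (v = j) \<le> Poly_Mapping.lookup m v"
    unfolding packing_exponents_def by (auto elim: packs_SucE)
  let ?e = "Poly_Mapping.single i 1 + Poly_Mapping.single j (1 :: nat)"
  have e: "Poly_Mapping.lookup ?e v = of_bool (v = i) + of_bool (v = j)" for v
    by (auto simp: lookup_add lookup_single when_def)
  \<comment> \<open>Subtraction of exponents is truncated, so this rests on \<open>?e\<close> being
    pointwise below \<open>m\<close>.\<close>
  have "m = (m - ?e) + ?e"
  proof (rule poly_mapping_eqI)
    fix v
    have "Poly_Mapping.lookup ?e v \<le> Poly_Mapping.lookup m v"
      using g(3)[of v] unfolding e by linarith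
    then show "Poly_Mapping.lookup m v = Poly_Mapping.lookup (m - ?e + ?e) v"
      by (simp only: lookup_add[of "m - ?e" ?e] lookup_minus le_add_diff_inverse2)
  qed
  moreover have "g v \<le> Poly_Mapping.lookup (m - ?e) v" for v
    using g(3)[of v] unfolding lookup_minus e by linarith
  then have "m - ?e \<in> packing_exponents E n"
    unfolding packing_exponents_def using packs_mono[OF g(2)] by blast
  ultimately show "m \<in> {m + (Poly_Mapping.single i 1 + Poly_Mapping.single j 1) | m i j.
    m \<in> packing_exponents E n \<and> (i, j) \<in> E}"
    using g(1) by blast
next
  fix m assume "m \<in> {m + (Poly_Mapping.single i 1 + Poly_Mapping.single j 1) | m i j.
    m \<in> packing_exponents E n \<and> (i, j) \<in> E}"
  then obtain m' i j where m: "m = m' + (Poly_Mapping.single i 1 + Poly_Mapping.single j 1)"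
    "packs E n (Poly_Mapping.lookup m')" "(i, j) \<in> E"
    unfolding packing_exponents_def by blast
  have "packs E (Suc n) (Poly_Mapping.lookup m)"
    by (rule packs_SucI[OF m(3,2)]) (auto simp: m(1) lookup_add lookup_single when_def)
  then show "m \<in> packing_exponents E (Suc n)"
    by (simp add: packing_exponents_def)
qed

lemma mvar_mult: "mvar i * mvar j = Poly_Mapping.single (Poly_Mapping.single i 1 + Poly_Mapping.single j 1) 1"
  by (simp add: mvar_def mult_single)

text \<open>Exponents add under multiplication, which gives one inclusion by induction on
  \<open>n\<close>. For the other, \<open>packing_exponents_Suc\<close> splits each term into a term
  of the previous power and a generator \<open>x_i x_j\<close>.\<close>

lemma edge_ideal_power:
  fixes E :: "('n \<times> 'n) set"
  shows "(edge_ideal E :: ('n, 'k::field) mpoly set) [^]\<^bsub>ideals_set mpoly_ring\<^esub> n =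
    supported_on (packing_exponents E n)"
proof -
  interpret R: cring "mpoly_ring :: ('n, 'k) mpoly ring"
    by (rule cring_mpoly_ring)
  let ?I = "edge_ideal E :: ('n, 'k) mpoly set"
  have gen: "mvar i * mvar j \<in> ?I" if "(i, j) \<in> E" for i j
    unfolding edge_ideal_def using R.genideal_self that by (fastforce)
  have "?I \<subseteq> supported_on (packing_exponents E 1)"
    unfolding edge_ideal_def
  proof (rule R.genideal_minimal[OF ideal_supported_on])
    show "r + m \<in> packing_exponents E 1" if "m \<in> packing_exponents E 1" for m r
      using that by (rule packing_exponents_up)
    have "Poly_Mapping.single i 1 + Poly_Mapping.single j 1 \<in> packing_exponents E 1" if "(i, j) \<in> E" for i j
      unfolding One_nat_def packing_exponents_Suc using that
      by (intro CollectI exI[of _ 0] exI[of _ i] exI[of _ j]) (simp add: packing_exponents_def)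
    then show "{mvar i * mvar j |i j. (i, j) \<in> E} \<subseteq> (supported_on (packing_exponents E 1) :: ('n, 'k) mpoly set)"
      by (auto simp: mvar_mult supported_on_def)
  qed
  note I_sub = this
  have ideal: "ideal (supported_on (packing_exponents E n) :: ('n, 'k) mpoly set) mpoly_ring" for n
    by (rule ideal_supported_on) (rule packing_exponents_up)
  \<comment> \<open>The power in \<open>ideals_set\<close> starts from the whole ring, matching the
    empty packing, which fits into every exponent.\<close>
  have "rec_nat UNIV (\<lambda>_ H. ideal_prod mpoly_ring H ?I) n = supported_on (packing_exponents E n)"
  proof (induction n)
    case 0
    then show ?case
      by (simp add: packing_exponents_def supported_on_def)
  next
    case (Suc n)
    let ?P = "ideal_prod mpoly_ring (supported_on (packing_exponents E n)) ?I"
    have "?P \<subseteq> supported_on (packing_exponents E (Suc n))"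
    proof
      fix f assume "f \<in> ?P"
      then show "f \<in> supported_on (packing_exponents E (Suc n))"
      proof induction
        case (prod f g)
        have "a + b \<in> packing_exponents E (Suc n)"
          if "a \<in> packing_exponents E n" "b \<in> packing_exponents E 1" for a b
          using packs_add[of E n "Poly_Mapping.lookup a" 1 "Poly_Mapping.lookup b"] that
          by (simp add: packing_exponents_def lookup_add[abs_def])
        then show ?case
          using supported_on_mult[OF prod(1) subsetD[OF I_sub prod(2)]] by simp
      qed (auto simp: supported_on_closed)
    qed
    moreover have "supported_on (packing_exponents E (Suc n)) \<subseteq> ?P"
    proof (rule supported_on_subset)
      fix m :: "'n \<Rightarrow>\<^sub>0 nat" and c :: 'k
      assume "m \<in> packing_exponents E (Suc n)"
      then obtain m' i j where m: "m = m' + (Poly_Mapping.single i 1 + Poly_Mapping.single j 1)"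
        "m' \<in> packing_exponents E n" "(i, j) \<in> E"
        unfolding packing_exponents_Suc by blast
      have "Poly_Mapping.single m' c \<in> supported_on (packing_exponents E n)"
        using m(2) by (simp add: supported_on_def)
      from ideal_prod.prod[OF this gen[OF m(3)], of mpoly_ring]
      show "Poly_Mapping.single m c \<in> ?P"
        by (simp add: mvar_mult mult_single m(1))
    next
      have "ideal ?I mpoly_ring"
        unfolding edge_ideal_def by (rule R.genideal_ideal) simp
      then interpret P: ideal ?P mpoly_ring
        by (rule R.ideal_prod_is_ideal[OF ideal])
      show "0 \<in> ?P"
        using P.zero_closed by simp
      show "f + g \<in> ?P" if "f \<in> ?P" "g \<in> ?P" for f g
        using ideal_prod.sum[OF that] by simp
    qed
    ultimately show ?case
      using Suc by simp
  qed
  then show ?thesis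
    by (simp add: nat_pow_def ideals_set_def)
qed

subsection \<open>The Stanley decomposition\<close>

abbreviation coset :: "('n, 'k::field) mpoly set \<Rightarrow> ('n, 'k) mpoly \<Rightarrow> ('n, 'k) mpoly set" where
  "coset J f \<equiv> J +>\<^bsub>mpoly_ring\<^esub> f"

locale mpoly_ideal = ideal J mpoly_ring for J :: "('n::finite, 'k::field) mpoly set"
begin

lemma coset_add: "set_add mpoly_ring (coset J f) (coset J g) = coset J (f + g)"
  using a_rcos_sum[of f g] by simp

lemma coset_mult: "rcoset_mult mpoly_ring J (coset J f) (coset J g) = coset J (f * g)"
  using rcoset_mult_add[of f g] by simp

lemma coset_eq_iff: "coset J f = coset J g \<longleftrightarrow> f - g \<in> J"
proof -
  have "h \<in> coset J f \<longleftrightarrow> h - f \<in> J" for f h :: "('n, 'k) mpoly"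
    unfolding a_r_coset_def r_coset_def by (force simp: algebra_simps)
  then show ?thesis
    using a_repr_independence'[of f g] a_rcos_self[of f] by (metis UNIV_I mpoly_ring_simps(1))
qed

lemma quotient_module_simps:
  "carrier (quotient_module J) = range (coset J)"
  "coset J f \<oplus>\<^bsub>quotient_module J\<^esub> coset J g = coset J (f + g)"
  "\<zero>\<^bsub>quotient_module J\<^esub> = coset J 0"
  "f \<odot>\<^bsub>quotient_module J\<^esub> coset J g = coset J (f * g)"
proof -
  show "carrier (quotient_module J) = range (coset J)"
    by (auto simp: quotient_module_def ring.defs FactRing_def A_RCOSETS_def')
  show "\<zero>\<^bsub>quotient_module J\<^esub> = coset J 0"
    by (simp add: quotient_module_def ring.defs FactRing_def a_r_coset_def r_coset_def)
qed (simp_all add: quotient_module_def ring.defs FactRing_def coset_add coset_mult)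

text \<open>Serves twice: for \<open>S/J\<close> itself, with \<open>A\<close> and \<open>G\<close>
  the whole ring, and for a Stanley space \<open>x^u K[Z]\<close> over \<open>K[Z]\<close>.\<close>

lemma module_coset_image:
  assumes A: "1 \<in> A" "\<And>f g. f \<in> A \<Longrightarrow> g \<in> A \<Longrightarrow> f + g \<in> A \<and> f * g \<in> A" "\<And>f. f \<in> A \<Longrightarrow> - f \<in> A"
    and G: "0 \<in> G" "\<And>f g. f \<in> G \<Longrightarrow> g \<in> G \<Longrightarrow> f + g \<in> G" "\<And>f. f \<in> G \<Longrightarrow> - f \<in> G"
    and AG: "\<And>f g. f \<in> A \<Longrightarrow> g \<in> G \<Longrightarrow> f * g \<in> G"
  shows "module (mpoly_ring\<lparr>carrier := A\<rparr>) (quotient_module J\<lparr>carrier := coset J ` G\<rparr>)"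
proof -
  have "0 \<in> A"
    using A(1) A(2)[of 1 "- 1"] A(3)[of 1] by simp
  have "cring (mpoly_ring\<lparr>carrier := A\<rparr>)"
  proof (rule cringI)
    show "abelian_group (mpoly_ring\<lparr>carrier := A\<rparr>)"
      by (rule abelian_groupI) (use A \<open>0 \<in> A\<close> in \<open>auto simp: algebra_simps intro!: bexI[of _ "- _"]\<close>)
    show "Group.comm_monoid (mpoly_ring\<lparr>carrier := A\<rparr>)"
      by (rule comm_monoidI) (use A in \<open>auto simp: algebra_simps\<close>)
  qed (simp add: algebra_simps)
  moreover have "abelian_group (quotient_module J\<lparr>carrier := coset J ` G\<rparr>)"
  proof (rule abelian_groupI)
    fix x assume "x \<in> carrier (quotient_module J\<lparr>carrier := coset J ` G\<rparr>)"
    then obtain f where f: "f \<in> G" "x = coset J f"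
      by auto
    then show "\<exists>y\<in>carrier (quotient_module J\<lparr>carrier := coset J ` G\<rparr>).
        y \<oplus>\<^bsub>quotient_module J\<lparr>carrier := coset J ` G\<rparr>\<^esub> x = \<zero>\<^bsub>quotient_module J\<lparr>carrier := coset J ` G\<rparr>\<^esub>"
      using G(3) by (intro bexI[of _ "coset J (- f)"]) (simp_all add: quotient_module_simps)
  qed (use G in \<open>auto simp: quotient_module_simps add_ac\<close>)
  ultimately show ?thesis
    by (rule moduleI) (use AG in \<open>auto simp: quotient_module_simps algebra_simps\<close>)
qed

lemma module_quotient: "module mpoly_ring (quotient_module J)"
proof -
  have ring_eq: "(mpoly_ring :: ('n, 'k) mpoly ring)\<lparr>carrier := UNIV\<rparr> = mpoly_ring"
    by (simp add: ring_of_type_algebra_def)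
  have module_eq: "quotient_module J\<lparr>carrier := range (coset J)\<rparr> = quotient_module J"
    unfolding quotient_module_simps(1)[symmetric] by simp
  have "module (mpoly_ring\<lparr>carrier := UNIV\<rparr>) (quotient_module J\<lparr>carrier := range (coset J)\<rparr>)"
    by (rule module_coset_image) auto
  then show ?thesis
    unfolding ring_eq module_eq .
qed

lemma finsum_coset:
  assumes "finite L"
  shows "finsum (quotient_module J) (\<lambda>u. coset J (g u)) L = coset J (sum g L)"
proof -
  interpret M: module mpoly_ring "quotient_module J"
    by (rule module_quotient)
  show ?thesis
    using assms
  proof (induction L rule: finite_induct)
    case (insert u L)
    then show ?case
      by (subst M.finsum_insert) (auto simp: quotient_module_simps)
  qed (simp add: quotient_module_simps)
qed

end

section \<open>Orthants as Stanley spaces\<close>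

definition mpoly_monom :: "('n::finite \<Rightarrow> nat) \<Rightarrow> ('n, 'k::field) mpoly" where
  "mpoly_monom u = Poly_Mapping.single (Abs_poly_mapping u) 1"

text \<open>This is \<open>x^u K[Z]\<close> inside \<open>S\<close>, described by its monomials; see
  \<open>cone_polys_eq\<close>.\<close>

definition cone_polys :: "('n \<Rightarrow> nat) \<Rightarrow> 'n set \<Rightarrow> ('n, 'k::field) mpoly set" where
  "cone_polys u Z = supported_on {m. Poly_Mapping.lookup m \<in> cone u Z}"

lemma polys_in_eq: "polys_in Z = supported_on {m. Poly_Mapping.keys m \<subseteq> Z}"
  by (auto simp: polys_in_def supported_on_def)

lemma polys_in_closed:
  "1 \<in> polys_in Z"
  "f \<in> polys_in Z \<Longrightarrow> g \<in> polys_in Z \<Longrightarrow> f + g \<in> polys_in Z"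
  "f \<in> polys_in Z \<Longrightarrow> - f \<in> polys_in Z"
  "f \<in> polys_in Z \<Longrightarrow> g \<in> polys_in Z \<Longrightarrow> f * g \<in> polys_in Z"
proof -
  show "1 \<in> polys_in Z"
    by (auto simp: polys_in_def)
  show "f * g \<in> polys_in Z" if "f \<in> polys_in Z" "g \<in> polys_in Z"
    using that unfolding polys_in_eq
  proof (rule supported_on_mult)
    show "a + b \<in> {m. Poly_Mapping.keys m \<subseteq> Z}"
      if "a \<in> {m. Poly_Mapping.keys m \<subseteq> Z}" "b \<in> {m. Poly_Mapping.keys m \<subseteq> Z}" for a b :: "'a \<Rightarrow>\<^sub>0 nat"
      using that keys_add[of a b] by blast
  qed
qed (simp_all add: polys_in_eq supported_on_closed)

lemma cone_polys_mult: "f \<in> polys_in Z \<Longrightarrow> g \<in> cone_polys u Z \<Longrightarrow> f * g \<in> cone_polys u Z"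
  unfolding polys_in_eq cone_polys_def
  by (erule (1) supported_on_mult) (auto simp: cone_def lookup_add in_keys_iff intro: le_add2 order_trans trans_le_add2)

lemma monom_in_cone_polys: "mpoly_monom u \<in> cone_polys u Z"
  by (simp add: mpoly_monom_def cone_polys_def supported_on_def cone_def)

lemma cone_polys_eq: "cone_polys u Z = (\<lambda>f. f * mpoly_monom u) ` polys_in Z"
proof (intro Set.set_eqI iffI)
  fix g :: "('a, 'b) mpoly" assume g: "g \<in> cone_polys u Z"
  let ?u = "Abs_poly_mapping u"
  \<comment> \<open>\<open>?f\<close> is \<open>g\<close> divided by \<open>x^u\<close> term by
    term; the subtraction is exact because every exponent of \<open>g\<close> lies above
    \<open>u\<close>.\<close>
  let ?f = "\<Sum>m\<in>Poly_Mapping.keys g. Poly_Mapping.single (m - ?u) (Poly_Mapping.lookup g m)"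
  have cone: "Poly_Mapping.lookup m \<in> cone u Z" if "m \<in> Poly_Mapping.keys g" for m
    using g that by (auto simp: cone_polys_def supported_on_def)
  have "m - ?u + ?u = m" if "m \<in> Poly_Mapping.keys g" for m
    using cone[OF that] by (intro poly_mapping_eqI) (simp add: lookup_add[of "m - ?u" ?u] lookup_minus cone_def)
  then have "?f * mpoly_monom u = g"
    unfolding mpoly_monom_def sum_distrib_right mult_single
    by (simp add: poly_mapping_sum_single cong: sum.cong)
  moreover have "Poly_Mapping.keys (m - ?u) \<subseteq> Z" if "m \<in> Poly_Mapping.keys g" for m
    using cone[OF that] by (auto simp: in_keys_iff lookup_minus cone_def)
  then have "?f \<in> polys_in Z"
    unfolding polys_in_eq supported_on_iff lookup_sum lookup_single
    by (intro allI impI sum.neutral ballI) (metis mem_Collect_eq when_neq_zero)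
  ultimately show "g \<in> (\<lambda>f. f * mpoly_monom u) ` polys_in Z"
    using image_eqI[of g "\<lambda>f. f * mpoly_monom u" ?f] by simp
next
  fix g :: "('a, 'b) mpoly" assume "g \<in> (\<lambda>f. f * mpoly_monom u) ` polys_in Z"
  then show "g \<in> cone_polys u Z"
    using cone_polys_mult[OF _ monom_in_cone_polys] by blast
qed

lemma mult_monom_eq_0: "f * mpoly_monom u = 0 \<Longrightarrow> f = 0"
  using lookup_mult_single[of f "Abs_poly_mapping u"] unfolding mpoly_monom_def
  by (intro poly_mapping_eqI) (metis lookup_zero)

lemma (in mpoly_ideal) mult_space_eq: "mult_space (quotient_module J) (coset J (mpoly_monom u)) Z = coset J ` cone_polys u Z"
  unfolding mult_space_def cone_polys_eq image_image by (simp add: quotient_module_simps)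

text \<open>The coset of \<open>x^u\<close> is a one-element basis: as \<open>x^u K[Z]\<close> meets
  \<open>J\<close> only in 0, a multiple \<open>f * x^u\<close> is determined by its coset, and
  \<open>f\<close> by that multiple.\<close>

lemma (in mpoly_ideal) stanley_space_monom:
  assumes free: "cone_polys u Z \<inter> J = {0}"
  shows "stanley_space (quotient_module J) (quotient_grading J) (coset J (mpoly_monom u)) Z"
proof -
  let ?w = "coset J (mpoly_monom u)"
  let ?R = "mpoly_ring\<lparr>carrier := polys_in Z\<rparr> :: ('n, 'k) mpoly ring"
  let ?M = "quotient_module J\<lparr>carrier := mult_space (quotient_module J) ?w Z\<rparr>"
  have "module ?R ?M"
    unfolding mult_space_eq
    by (rule module_coset_image)
      (auto simp: polys_in_closed cone_polys_mult, auto simp: cone_polys_def supported_on_closed)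
  then interpret M: module ?R ?M .
  have w: "?w \<in> mult_space (quotient_module J) ?w Z"
    unfolding mult_space_eq using monom_in_cone_polys by blast
  \<comment> \<open>\<open>free_module\<close> sums only over nonzero coefficients, so for
    \<open>c ?w = 0\<close> the sum is empty and equals the coset of 0.\<close>
  have sum_w: "finsum ?M (\<lambda>b. c b \<odot>\<^bsub>?M\<^esub> b) {b \<in> {?w}. c b \<noteq> \<zero>\<^bsub>?R\<^esub>} = coset J (c ?w * mpoly_monom u)"
    if "c ?w \<in> polys_in Z" for c
  proof (cases "c ?w = 0")
    case True
    then have "{b \<in> {?w}. c b \<noteq> \<zero>\<^bsub>?R\<^esub>} = {}"
      by auto
    then show ?thesis
      using True by (simp only: M.finsum_empty) (simp add: quotient_module_simps)
  next
    case False
    then have "{b \<in> {?w}. c b \<noteq> \<zero>\<^bsub>?R\<^esub>} = {?w}"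
      by auto
    moreover have "coset J (c ?w * mpoly_monom u) \<in> carrier ?M"
      using that by (auto simp: mult_space_eq cone_polys_eq)
    ultimately show ?thesis
      using M.finsum_insert[of "{}" ?w "\<lambda>b. c b \<odot>\<^bsub>?M\<^esub> b"] by (simp add: quotient_module_simps M.r_zero[simplified])
  qed
  have "\<exists>!c. c \<in> {?w} \<rightarrow>\<^sub>E carrier ?R \<and> finite {b \<in> {?w}. c b \<noteq> \<zero>\<^bsub>?R\<^esub>} \<and>
      x = finsum ?M (\<lambda>b. c b \<odot>\<^bsub>?M\<^esub> b) {b \<in> {?w}. c b \<noteq> \<zero>\<^bsub>?R\<^esub>}" if x: "x \<in> carrier ?M" for x
  proof -
    obtain f where f: "f \<in> polys_in Z" "x = coset J (f * mpoly_monom u)"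
      using x by (auto simp: mult_space_eq cone_polys_eq)
    show ?thesis
    proof (rule ex1I[of _ "\<lambda>b\<in>{?w}. f"])
      show "(\<lambda>b\<in>{?w}. f) \<in> {?w} \<rightarrow>\<^sub>E carrier ?R \<and> finite {b \<in> {?w}. (\<lambda>b\<in>{?w}. f) b \<noteq> \<zero>\<^bsub>?R\<^esub>} \<and>
        x = finsum ?M (\<lambda>b. (\<lambda>b\<in>{?w}. f) b \<odot>\<^bsub>?M\<^esub> b) {b \<in> {?w}. (\<lambda>b\<in>{?w}. f) b \<noteq> \<zero>\<^bsub>?R\<^esub>}"
        using f by (subst sum_w) auto
    next
      fix c assume c: "c \<in> {?w} \<rightarrow>\<^sub>E carrier ?R \<and> finite {b \<in> {?w}. c b \<noteq> \<zero>\<^bsub>?R\<^esub>} \<and>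
        x = finsum ?M (\<lambda>b. c b \<odot>\<^bsub>?M\<^esub> b) {b \<in> {?w}. c b \<noteq> \<zero>\<^bsub>?R\<^esub>}"
      then have cw: "c ?w \<in> polys_in Z"
        by auto
      then have "coset J (c ?w * mpoly_monom u) = coset J (f * mpoly_monom u)"
        using c sum_w f(2) by simp
      then have "(c ?w - f) * mpoly_monom u \<in> J"
        unfolding coset_eq_iff left_diff_distrib .
      moreover have "c ?w - f \<in> polys_in Z"
        using cw f(1) by (simp add: polys_in_eq supported_on_closed)
      then have "(c ?w - f) * mpoly_monom u \<in> cone_polys u Z"
        unfolding cone_polys_eq by blast
      ultimately have "(c ?w - f) * mpoly_monom u = 0"
        using free by blast
      then have "c ?w = f"
        using mult_monom_eq_0 by fastforce
      then show "c = (\<lambda>b\<in>{?w}. f)"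
        using c by (intro PiE_ext[of c "{?w}" "\<lambda>_. UNIV"]) auto
    qed
  qed
  then have "free_module ?R ?M"
    unfolding free_module_def using \<open>module ?R ?M\<close> w by (intro conjI exI[of _ "{?w}"]) auto
  moreover have "?w \<in> quotient_grading J (\<lambda>i. int (u i))"
    unfolding quotient_grading_def by (rule imageI) (simp add: mpoly_monom_def)
  ultimately show ?thesis
    unfolding stanley_space_def homogeneous_def by (auto simp: quotient_module_simps)
qed

text \<open>Each exponent outside \<open>U\<close> lies in exactly one cone, so modulo
  \<open>J\<close> the terms of a polynomial are distributed uniquely over the cones.\<close>

lemma (in mpoly_ideal) stanley_decomposition_cones:
  assumes J: "J = supported_on U" and "finite L"
    and cover: "\<And>m. m \<notin> U \<longleftrightarrow> (\<exists>u\<in>L. Poly_Mapping.lookup m \<in> cone u (Z u))"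
    and disj: "disjoint_family_on (\<lambda>u. cone u (Z u)) L"
  shows "stanley_decomposition (quotient_module J) (quotient_grading J) ((\<lambda>u. (coset J (mpoly_monom u), Z u)) ` L)"
    (is "stanley_decomposition ?M _ (?\<phi> ` L)")
proof -
  interpret M: module mpoly_ring ?M
    by (rule module_quotient)
  have disj: "u = u'" if "u \<in> L" "u' \<in> L" "m \<in> cone u (Z u)" "m \<in> cone u' (Z u')" for u u' m
    using disj that unfolding disjoint_family_on_def by blast
  have cone_notin: "Poly_Mapping.lookup m \<in> cone u (Z u) \<Longrightarrow> m \<notin> U" if "u \<in> L" for u m
    using that cover by blast
  have free: "f = 0" if "u \<in> L" "f \<in> cone_polys u (Z u)" "f \<in> J" for u f
    using that cone_notin[OF that(1)] unfolding J cone_polys_def supported_on_iff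
    by (intro poly_mapping_eqI) (metis lookup_zero mem_Collect_eq)
  \<comment> \<open>A decomposition is a set of pairs; injectivity lets sums over it be reindexed by
    \<open>L\<close>. If \<open>x^u\<close> and \<open>x^u'\<close> had the same coset, the
    coefficient of their difference at \<open>u\<close> would vanish, because \<open>u\<close> lies
    outside \<open>U\<close>.\<close>
  have inj: "inj_on ?\<phi> L"
  proof (rule inj_onI)
    fix u u' assume u: "u \<in> L" "u' \<in> L" "?\<phi> u = ?\<phi> u'"
    then have "mpoly_monom u - mpoly_monom u' \<in> J"
      by (simp add: coset_eq_iff)
    then have "(mpoly_monom u - mpoly_monom u' :: ('n, 'k) mpoly) \<in> supported_on U"
      using J by blast
    moreover have "Abs_poly_mapping u \<notin> U"
      using cone_notin[OF u(1)] by (simp add: cone_def)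
    ultimately have "Poly_Mapping.lookup (mpoly_monom u - mpoly_monom u' :: ('n, 'k) mpoly) (Abs_poly_mapping u) = 0"
      by (simp add: supported_on_iff)
    then have "Abs_poly_mapping u = Abs_poly_mapping u'"
      by (simp add: lookup_minus mpoly_monom_def lookup_single when_def split: if_splits)
    then show "u = u'"
      by (simp add: Abs_poly_mapping_inject)
  qed
  let ?S = "\<lambda>(w, Z). mult_space ?M w Z"
  have S: "?S (?\<phi> u) = coset J ` cone_polys u (Z u)" for u
    by (simp add: mult_space_eq)
  have finsum_\<phi>: "finsum ?M F (?\<phi> ` L) = coset J (sum g L)"
    if "\<And>u. u \<in> L \<Longrightarrow> F (?\<phi> u) = coset J (g u)" for F g
  proof -
    have "finsum ?M F (?\<phi> ` L) = finsum ?M (\<lambda>u. F (?\<phi> u)) L"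
      using that by (intro M.finsum_reindex inj) (auto simp: quotient_module_simps)
    also have "\<dots> = finsum ?M (\<lambda>u. coset J (g u)) L"
      using that by (intro M.finsum_cong) (auto simp: quotient_module_simps simp_implies_def)
    finally show ?thesis
      using finsum_coset[OF \<open>finite L\<close>] by simp
  qed
  have "\<exists>!F. F \<in> Pi\<^sub>E (?\<phi> ` L) ?S \<and> finsum ?M F (?\<phi> ` L) = x" if x: "x \<in> carrier ?M" for x
  proof (rule ex_ex1I)
    obtain f where f: "x = coset J f"
      using x by (auto simp: quotient_module_simps)
    \<comment> \<open>\<open>part u\<close> keeps the terms of \<open>f\<close> with exponents in
      the cone of \<open>u\<close>; terms in no cone have exponents in \<open>U\<close> and vanish
      in the quotient.\<close>
    define part where "part u = Poly_Mapping.mapp (\<lambda>m c. c when Poly_Mapping.lookup m \<in> cone u (Z u)) f" for u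
    have part: "Poly_Mapping.lookup (part u) m = (Poly_Mapping.lookup f m when Poly_Mapping.lookup m \<in> cone u (Z u))" for u m
      unfolding part_def by (auto simp: lookup_mapp in_keys_iff when_def)
    have part_cone: "part u \<in> cone_polys u (Z u)" for u
      unfolding cone_polys_def supported_on_iff by (simp add: part)
    have "sum part L - f \<in> J"
      unfolding J supported_on_iff
    proof (intro allI impI)
      fix m assume "m \<notin> U"
      then obtain u where u: "u \<in> L" "Poly_Mapping.lookup m \<in> cone u (Z u)"
        using cover by blast
      have "Poly_Mapping.lookup (sum part L) m = (\<Sum>u'\<in>L. if u' = u then Poly_Mapping.lookup f m else 0)"
        unfolding lookup_sum part by (intro sum.cong) (use disj u in \<open>auto simp: when_def\<close>)
      then show "Poly_Mapping.lookup (sum part L - f) m = 0"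
        using u(1) \<open>finite L\<close> by (simp add: lookup_minus)
    qed
    then have sum_part: "coset J (sum part L) = x"
      unfolding f coset_eq_iff .
    define F where "F = (\<lambda>q\<in>?\<phi> ` L. coset J (part (the_inv_into L ?\<phi> q)))"
    have F: "F (?\<phi> u) = coset J (part u)" if "u \<in> L" for u
      using that by (simp add: F_def the_inv_into_f_f[OF inj])
    have "F \<in> Pi\<^sub>E (?\<phi> ` L) ?S"
    proof (rule PiE_I)
      fix q assume "q \<in> ?\<phi> ` L"
      then obtain u where "u \<in> L" "q = ?\<phi> u"
        by blast
      then show "F q \<in> ?S q"
        using F part_cone by (simp only: S) blast
    qed (simp add: F_def)
    moreover have "finsum ?M F (?\<phi> ` L) = x"
      using finsum_\<phi>[of F part, OF F] sum_part by simp
    ultimately show "\<exists>F. F \<in> Pi\<^sub>E (?\<phi> ` L) ?S \<and> finsum ?M F (?\<phi> ` L) = x"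
      by blast
  next
    fix F F' assume F: "F \<in> Pi\<^sub>E (?\<phi> ` L) ?S \<and> finsum ?M F (?\<phi> ` L) = x"
      and F': "F' \<in> Pi\<^sub>E (?\<phi> ` L) ?S \<and> finsum ?M F' (?\<phi> ` L) = x"
    \<comment> \<open>Representatives inside the cones turn equality of cosets into equality of
      coefficients outside \<open>U\<close>.\<close>
    have rep: "\<exists>g. \<forall>u\<in>L. g u \<in> cone_polys u (Z u) \<and> H (?\<phi> u) = coset J (g u)"
      if "H \<in> Pi\<^sub>E (?\<phi> ` L) ?S" for H
    proof (rule bchoice, rule ballI)
      fix u assume "u \<in> L"
      then have "H (?\<phi> u) \<in> ?S (?\<phi> u)"
        using that PiE_mem[of H "?\<phi> ` L" ?S "?\<phi> u"] by blast
      then show "\<exists>g. g \<in> cone_polys u (Z u) \<and> H (?\<phi> u) = coset J g"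
        unfolding S by blast
    qed
    obtain g where "\<forall>u\<in>L. g u \<in> cone_polys u (Z u) \<and> F (?\<phi> u) = coset J (g u)"
      using rep[OF conjunct1[OF F]] by (rule exE)
    then have g: "\<And>u. u \<in> L \<Longrightarrow> g u \<in> cone_polys u (Z u)" "\<And>u. u \<in> L \<Longrightarrow> F (?\<phi> u) = coset J (g u)"
      by blast+
    obtain g' where "\<forall>u\<in>L. g' u \<in> cone_polys u (Z u) \<and> F' (?\<phi> u) = coset J (g' u)"
      using rep[OF conjunct1[OF F']] by (rule exE)
    then have g': "\<And>u. u \<in> L \<Longrightarrow> g' u \<in> cone_polys u (Z u)" "\<And>u. u \<in> L \<Longrightarrow> F' (?\<phi> u) = coset J (g' u)"
      by blast+
    have "coset J (sum g L) = coset J (sum g' L)"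
      using F F' finsum_\<phi>[of F g, OF g(2)] finsum_\<phi>[of F' g', OF g'(2)] by simp
    then have diff: "(\<Sum>u\<in>L. g u - g' u) \<in> supported_on U"
      unfolding coset_eq_iff sum_subtractf[symmetric] using J by blast
    have cone_diff: "g u - g' u \<in> cone_polys u (Z u)" if "u \<in> L" for u
      using g(1)[OF that] g'(1)[OF that] unfolding cone_polys_def by (rule supported_on_closed)
    \<comment> \<open>By \<open>free\<close> it suffices that the difference lies in
      \<open>J\<close>. At an exponent outside \<open>U\<close>, only the summand of its own cone
      contributes to the sum in \<open>diff\<close>, whose coefficient there is 0.\<close>
    have "g u - g' u = 0" if u: "u \<in> L" for u
    proof (rule free[OF u cone_diff[OF u]], unfold J supported_on_iff, intro allI impI)
      fix m assume "m \<notin> U"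
      show "Poly_Mapping.lookup (g u - g' u) m = 0"
      proof (cases "Poly_Mapping.lookup m \<in> cone u (Z u)")
        case True
        have "Poly_Mapping.lookup (g u' - g' u') m = 0" if "u' \<in> L" "u' \<noteq> u" for u'
        proof -
          have "Poly_Mapping.lookup m \<notin> cone u' (Z u')"
            using disj[OF that(1) u _ True] that(2) by blast
          then show ?thesis
            using cone_diff[OF that(1)] by (simp add: cone_polys_def supported_on_iff)
        qed
        then have "Poly_Mapping.lookup (\<Sum>u\<in>L. g u - g' u) m = (\<Sum>u'\<in>L. if u' = u then Poly_Mapping.lookup (g u - g' u) m else 0)"
          unfolding lookup_sum by (intro sum.cong) auto
        then show ?thesis
          using diff \<open>m \<notin> U\<close> u \<open>finite L\<close> by (simp add: supported_on_iff)
      next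
        case False
        then show ?thesis
          using cone_diff[OF u] by (simp add: cone_polys_def supported_on_iff)
      qed
    qed
    then have "F (?\<phi> u) = F' (?\<phi> u)" if "u \<in> L" for u
      using g(2)[OF that] g'(2)[OF that] that by simp
    then show "F = F'"
      using F F' by (intro PiE_ext[of F "?\<phi> ` L" ?S F']) auto
  qed
  moreover have "stanley_space ?M (quotient_grading J) (coset J (mpoly_monom u)) (Z u)" if "u \<in> L" for u
  proof (rule stanley_space_monom)
    have "0 \<in> J"
      unfolding J by (rule supported_on_closed)
    moreover have "0 \<in> cone_polys u (Z u)"
      unfolding cone_polys_def by (rule supported_on_closed)
    ultimately show "cone_polys u (Z u) \<inter> J = {0}"
      using free[OF that] by blast
  qed
  ultimately show ?thesis
    unfolding stanley_decomposition_def using \<open>finite L\<close> by auto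
qed

theorem theorem2p3:
  fixes E :: "('n::finite \<times> 'n) set"
    and I J :: "('n, 'k::field) mpoly set"
    and p k :: nat
  assumes "sym E" and "irrefl E"
    and "I = edge_ideal E"
    and "p = card {C \<in> components E. bipartite_on E C}"
    and "k \<ge> 1"
    and "J = I [^]\<^bsub>ideals_set mpoly_ring\<^esub> k"
  shows "sdepth (quotient_module J) (quotient_grading J) \<ge> enat p"
proof -
  have J: "J = supported_on (packing_exponents E k)"
    using assms(3,6) edge_ideal_power by blast
  interpret mpoly_ideal J
    unfolding mpoly_ideal_def J by (rule ideal_supported_on) (rule packing_exponents_up)
  obtain L :: "('n \<Rightarrow> nat) set" and Z where L: "finite L" "\<forall>u\<in>L. p \<le> card (Z u)"
    "{m. \<not> packs E k m} = (\<Union>u\<in>L. cone u (Z u))" "disjoint_family_on (\<lambda>u. cone u (Z u)) L"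
    using not_packs_cones[OF assms(1)] assms(4) by metis
  \<comment> \<open>The monomials outside \<open>J\<close> are those whose exponents lie in the
    cones of \<open>not_packs_cones\<close>, each with at least \<open>p\<close> directions.\<close>
  have "m \<notin> packing_exponents E k \<longleftrightarrow> (\<exists>u\<in>L. Poly_Mapping.lookup m \<in> cone u (Z u))" for m
    using L(3) unfolding packing_exponents_def by auto
  then have "stanley_decomposition (quotient_module J) (quotient_grading J) ((\<lambda>u. (coset J (mpoly_monom u), Z u)) ` L)"
    using L by (intro stanley_decomposition_cones[OF J]) auto
  moreover have "enat p \<le> sdepth_decomposition ((\<lambda>u. (coset J (mpoly_monom u), Z u)) ` L)"
    unfolding sdepth_decomposition_def using L(2) by (auto intro!: INF_greatest)
  ultimately show ?thesis
    unfolding sdepth_def by (intro SUP_upper2) auto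
qed

end
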